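(* Let $S$ be a finite non-empty set and $p:2^S\to\mathbb{Z}\cup\{-\infty\}$ a supermodular function with $p(\emptyset)=0$ and $p(S)$ finite; let $B=\{x\in\mathbb{R}^S:\widetilde x(S)=p(S),\ \widetilde x(Z)\ge p(Z)\ \forall Z\subseteq S\}$ and let $\beta_1$ be the smallest integer for which $B\cap\mathbb{Z}^S$ has a $\beta_1$-covered element. For a $\beta_1$-covered element $m\in B\cap\mathbb{Z}^S$ let $S_1(m)=\bigcup\{T_m(t):t\in S,\ m(t)=\beta_1\}$. Then a $\beta_1$-covered element $m$ of $B\cap\mathbb{Z}^S$ is pre-decreasingly minimal if and only if $m(s)\ge\beta_1-1$ for every $s\in S_1(m)$.
   Context: $\widetilde x(Z)=\sum_{s\in Z}x(s)$. A vector is $\beta$-covered if each of its components is at most $\beta$. For $m\in B$, a set $X$ is $m$-tight if $\widetilde m(X)=p(X)$; $m$-tight sets are closed under union and intersection, and $T_m(t)$ denotes the unique smallest $m$-tight set containing $t$. A $\beta_1$-covered element of $B\cap\mathbb{Z}^S$ is pre-decreasingly minimal (pre-dec-min) if the number of its components equal to $\beta_1$ is as small as possible among all $\beta_1$-covered elements of $B\cap\mathbb{Z}^S$. *)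

theory Defs
  imports Complex_Main "HOL-Library.Extended_Real" "HOL-Library.FuncSet"
begin

text \<open>
  The space of real vectors indexed by \<open>S\<close> is represented by the extensional functions
  \<open>S \<rightarrow>\<^sub>E UNIV\<close>, and the integer vectors by \<open>S \<rightarrow>\<^sub>E \<int>\<close>. Set functions
  are only constrained on subsets of \<open>S\<close>; the value \<open>-\<infinity>\<close> is that of \<open>ereal\<close>.
\<close>

definition integer_or_minus_infinity_valued :: "'a set \<Rightarrow> ('a set \<Rightarrow> ereal) \<Rightarrow> bool" where
  "integer_or_minus_infinity_valued S p \<longleftrightarrow>
     (\<forall>Z\<subseteq>S. p Z = -\<infinity> \<or> (\<exists>k::int. p Z = ereal (of_int k)))"

definition supermodular :: "'a set \<Rightarrow> ('a set \<Rightarrow> ereal) \<Rightarrow> bool" where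
  "supermodular S p \<longleftrightarrow> (\<forall>X\<subseteq>S. \<forall>Y\<subseteq>S. p X + p Y \<le> p (X \<union> Y) + p (X \<inter> Y))"

definition base_polyhedron :: "'a set \<Rightarrow> ('a set \<Rightarrow> ereal) \<Rightarrow> ('a \<Rightarrow> real) set" where
  "base_polyhedron S p =
     {x \<in> S \<rightarrow>\<^sub>E UNIV. ereal (sum x S) = p S \<and> (\<forall>Z\<subseteq>S. ereal (sum x Z) \<ge> p Z)}"

definition integral_bases :: "'a set \<Rightarrow> ('a set \<Rightarrow> ereal) \<Rightarrow> ('a \<Rightarrow> real) set" where
  "integral_bases S p = base_polyhedron S p \<inter> (S \<rightarrow>\<^sub>E \<int>)"

definition covered :: "'a set \<Rightarrow> int \<Rightarrow> ('a \<Rightarrow> real) \<Rightarrow> bool" where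
  "covered S \<beta> x \<longleftrightarrow> (\<forall>s\<in>S. x s \<le> of_int \<beta>)"

definition beta1 :: "'a set \<Rightarrow> ('a set \<Rightarrow> ereal) \<Rightarrow> int" where
  "beta1 S p = (LEAST \<beta>. \<exists>x\<in>integral_bases S p. covered S \<beta> x)"

definition tight :: "'a set \<Rightarrow> ('a set \<Rightarrow> ereal) \<Rightarrow> ('a \<Rightarrow> real) \<Rightarrow> 'a set \<Rightarrow> bool" where
  "tight S p m X \<longleftrightarrow> X \<subseteq> S \<and> ereal (sum m X) = p X"

text \<open>\<open>LEAST\<close> refers to the inclusion order on sets.\<close>

definition smallest_tight :: "'a set \<Rightarrow> ('a set \<Rightarrow> ereal) \<Rightarrow> ('a \<Rightarrow> real) \<Rightarrow> 'a \<Rightarrow> 'a set" where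
  "smallest_tight S p m t = (LEAST X. tight S p m X \<and> t \<in> X)"

definition S1 :: "'a set \<Rightarrow> ('a set \<Rightarrow> ereal) \<Rightarrow> ('a \<Rightarrow> real) \<Rightarrow> 'a set" where
  "S1 S p m = \<Union> {smallest_tight S p m t | t. t \<in> S \<and> m t = of_int (beta1 S p)}"

definition pre_dec_min :: "'a set \<Rightarrow> ('a set \<Rightarrow> ereal) \<Rightarrow> ('a \<Rightarrow> real) \<Rightarrow> bool" where
  "pre_dec_min S p m \<longleftrightarrow>
     m \<in> integral_bases S p \<and> covered S (beta1 S p) m \<and>
     (\<forall>x\<in>integral_bases S p. covered S (beta1 S p) x \<longrightarrow>
        card {s \<in> S. m s = of_int (beta1 S p)} \<le> card {s \<in> S. x s = of_int (beta1 S p)})"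

text \<open>The two uses of \<open>LEAST\<close> above are over orders that are not well-founded or not total;
  the following facts show that the least elements exist.\<close>

lemma beta1_least:
  assumes S: "finite S" "S \<noteq> {}" and ne: "integral_bases S p \<noteq> {}"
  shows "\<exists>x\<in>integral_bases S p. covered S (beta1 S p) x"
    and "\<And>\<beta> x. x \<in> integral_bases S p \<Longrightarrow> covered S \<beta> x \<Longrightarrow> beta1 S p \<le> \<beta>"
proof -
  let ?P = "\<lambda>\<beta>. \<exists>x\<in>integral_bases S p. covered S \<beta> x"
  obtain y where y: "y \<in> integral_bases S p" using ne by blast
  define c where "c = \<lfloor>sum y S / card S\<rfloor>"
  have card: "card S > 0" using S by (simp add: card_gt_0_iff)
  have lb: "c \<le> \<beta>" if P: "?P \<beta>" for \<beta>
  proof -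
    obtain x where x: "x \<in> integral_bases S p" "covered S \<beta> x" using P by blast
    have "ereal (sum x S) = ereal (sum y S)"
      using x(1) y by (auto simp: integral_bases_def base_polyhedron_def)
    moreover have "sum x S \<le> card S * real_of_int \<beta>"
      using sum_bounded_above[of S x "real_of_int \<beta>"] x(2) by (simp add: covered_def)
    ultimately have "sum y S / card S \<le> real_of_int \<beta>"
      using card by (simp add: field_simps)
    then show ?thesis unfolding c_def by linarith
  qed
  define u where "u = \<lceil>Max (y ` S)\<rceil>"
  have "y s \<le> u" if "s \<in> S" for s
  proof -
    have "y s \<le> Max (y ` S)" using S that by (intro Max_ge) auto
    then show ?thesis unfolding u_def using le_of_int_ceiling order_trans by blast
  qed
  then have u: "?P u" using y by (auto simp: covered_def)
  define k where "k = (LEAST n. ?P (c + int n))"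
  have ex: "?P (c + int (nat (u - c)))" using u lb[OF u] by simp
  have k: "?P (c + int k)" unfolding k_def by (rule LeastI[where P = "\<lambda>n. ?P (c + int n)", OF ex])
  have min: "c + int k \<le> \<beta>" if "?P \<beta>" for \<beta>
  proof -
    have "?P (c + int (nat (\<beta> - c)))" using that lb[OF that] by simp
    then have "k \<le> nat (\<beta> - c)" unfolding k_def by (rule Least_le)
    then show ?thesis using lb[OF that] by linarith
  qed
  have eq: "beta1 S p = c + int k"
    unfolding beta1_def by (rule Least_equality) (fact k, fact min)
  show "\<exists>x\<in>integral_bases S p. covered S (beta1 S p) x" using k eq by simp
  show "beta1 S p \<le> \<beta>" if "x \<in> integral_bases S p" "covered S \<beta> x" for \<beta> x
    using min that eq by auto
qed

lemma tight_Un_Int: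
  assumes S: "finite S" and p: "supermodular S p" and m: "m \<in> base_polyhedron S p"
    and X: "tight S p m X" and Y: "tight S p m Y"
  shows "tight S p m (X \<union> Y)" and "tight S p m (X \<inter> Y)"
proof -
  have sub: "X \<subseteq> S" "Y \<subseteq> S" using X Y by (auto simp: tight_def)
  have fin: "finite X" "finite Y" using sub S finite_subset by auto
  have "p X + p Y \<le> p (X \<union> Y) + p (X \<inter> Y)" using p sub by (auto simp: supermodular_def)
  moreover have "p X = ereal (sum m X)" "p Y = ereal (sum m Y)" using X Y by (auto simp: tight_def)
  moreover have "sum m X + sum m Y = sum m (X \<union> Y) + sum m (X \<inter> Y)"
    using sum.union_inter[OF fin, of m] by simp
  moreover have "p (X \<union> Y) \<le> ereal (sum m (X \<union> Y))" "p (X \<inter> Y) \<le> ereal (sum m (X \<inter> Y))"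
    using m sub by (auto simp: base_polyhedron_def le_infI1)
  ultimately have "ereal (sum m (X \<union> Y)) = p (X \<union> Y)" "ereal (sum m (X \<inter> Y)) = p (X \<inter> Y)"
    by (cases "p (X \<union> Y)"; cases "p (X \<inter> Y)"; simp)+
  then show "tight S p m (X \<union> Y)" "tight S p m (X \<inter> Y)" using sub by (auto simp: tight_def)
qed

lemma smallest_tight_least:
  assumes S: "finite S" and p: "supermodular S p" and m: "m \<in> base_polyhedron S p" and t: "t \<in> S"
  shows "tight S p m (smallest_tight S p m t)" and "t \<in> smallest_tight S p m t"
    and "\<And>X. tight S p m X \<Longrightarrow> t \<in> X \<Longrightarrow> smallest_tight S p m t \<subseteq> X"
proof -
  let ?F = "{X. tight S p m X \<and> t \<in> X}"
  have F: "finite ?F" by (rule finite_subset[of _ "Pow S"]) (use S in \<open>auto simp: tight_def\<close>)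
  have "S \<in> ?F" using m t by (auto simp: tight_def base_polyhedron_def)
  have "\<Inter>G \<in> ?F" if "finite G" "G \<noteq> {}" "G \<subseteq> ?F" for G
    using that by (induction G rule: finite_ne_induct) (auto intro: tight_Un_Int(2)[OF S p m])
  then have I: "\<Inter>?F \<in> ?F" using F \<open>S \<in> ?F\<close> by blast
  have eq: "smallest_tight S p m t = \<Inter>?F"
    unfolding smallest_tight_def by (rule Least_equality) (use I in auto)
  show "tight S p m (smallest_tight S p m t)" "t \<in> smallest_tight S p m t" using I eq by auto
  show "smallest_tight S p m t \<subseteq> X" if "tight S p m X" "t \<in> X" for X using that eq by auto
qed

end

theory Submission
  imports Defs
begin

text \<open>
  If \<open>s\<close> lies in the smallest tight set of \<open>t\<close>, no tight set separates \<open>t\<close> from \<open>s\<close>, so a unit can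
  be moved from \<open>t\<close> to \<open>s\<close> inside the integral bases; when \<open>m t = \<beta>\<^sub>1\<close> and \<open>m s \<le> \<beta>\<^sub>1 - 2\<close> this
  lowers the number of \<open>\<beta>\<^sub>1\<close>-components. Conversely, \<open>S\<^sub>1(m)\<close> is tight and contains
  every \<open>\<beta>\<^sub>1\<close>-component of \<open>m\<close>. Every \<open>\<beta>\<^sub>1\<close>-covered integral base has at least
  \<open>p(S\<^sub>1(m)) - (\<beta>\<^sub>1 - 1) |S\<^sub>1(m)|\<close> components equal to \<open>\<beta>\<^sub>1\<close>, and \<open>m\<close> attains this bound if
  \<open>m \<ge> \<beta>\<^sub>1 - 1\<close> on \<open>S\<^sub>1(m)\<close>.
\<close>

lemma Ints_less_imp_le_minus_1:
  fixes a b :: real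
  assumes "a \<in> \<int>" "b \<in> \<int>" "a < b"
  shows "a \<le> b - 1"
  using assms by (auto elim!: Ints_cases)

lemma sum_move_unit:
  fixes m :: "'a \<Rightarrow> real"
  assumes "finite Z" "s \<noteq> t"
  shows "sum (m(t := m t - 1, s := m s + 1)) Z
           = sum m Z + (if s \<in> Z then 1 else 0) - (if t \<in> Z then 1 else 0)"
proof -
  have "sum (m(t := m t - 1, s := m s + 1)) Z
      = (\<Sum>z\<in>Z. m z + (if z = s then 1 else 0) - (if z = t then 1 else 0))"
    using assms(2) by (intro sum.cong) auto
  then show ?thesis using assms(1) by (simp add: sum.distrib sum_subtractf)
qed

text \<open>Only a set that contains \<open>t\<close> but not \<open>s\<close> loses a unit. A tight
  set containing \<open>t\<close> includes the smallest one and hence \<open>s\<close>, so every set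
  that loses has positive slack.\<close>

lemma move_unit_integral_bases:
  assumes S: "finite S" and int: "integer_or_minus_infinity_valued S p" and p: "supermodular S p"
    and m: "m \<in> integral_bases S p" and t: "t \<in> S"
    and s: "s \<in> smallest_tight S p m t" "s \<noteq> t"
  shows "m(t := m t - 1, s := m s + 1) \<in> integral_bases S p"
proof -
  let ?x = "m(t := m t - 1, s := m s + 1)"
  have mB: "m \<in> base_polyhedron S p" and mZ: "m \<in> S \<rightarrow>\<^sub>E \<int>"
    using m by (auto simp: integral_bases_def)
  note T = smallest_tight_least[OF S p mB t]
  have sS: "s \<in> S" using T(1) s(1) by (auto simp: tight_def)
  have xZ: "?x \<in> S \<rightarrow>\<^sub>E \<int>" using mZ t sS by (auto simp: PiE_iff extensional_def)
  have "sum ?x S = sum m S" using sum_move_unit[OF S s(2)] t sS by simp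
  moreover have "p Z \<le> ereal (sum ?x Z)" if Z: "Z \<subseteq> S" for Z
  proof -
    have fin: "finite Z" using Z S finite_subset by blast
    have le: "p Z \<le> ereal (sum m Z)" using mB Z by (auto simp: base_polyhedron_def)
    show ?thesis
    proof (cases "t \<in> Z \<and> s \<notin> Z")
      case True
      then have "\<not> tight S p m Z" using T(3) s(1) by blast
      then have lt: "p Z < ereal (sum m Z)" using le Z by (auto simp: tight_def)
      \<comment> \<open>Integrality of \<open>m\<close> and \<open>p\<close> turns the strict
        inequality into a slack of at least one unit; the value -\<infinity> leaves nothing to
        check.\<close>
      have mZZ: "sum m Z \<in> \<int>" using mZ Z by (intro Ints_sum) (auto simp: PiE_iff)
      consider "p Z = -\<infinity>" | k :: int where "p Z = ereal (of_int k)"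
        using int Z by (auto simp: integer_or_minus_infinity_valued_def)
      then have "p Z \<le> ereal (sum m Z - 1)"
      proof cases
        case 2
        then show ?thesis using Ints_less_imp_le_minus_1[OF Ints_of_int[of k] mZZ] lt by simp
      qed simp
      then show ?thesis using sum_move_unit[OF fin s(2), of m] True by simp
    next
      case False
      then have "sum m Z \<le> sum ?x Z" using sum_move_unit[OF fin s(2), of m] by auto
      then show ?thesis using le order_trans ereal_less_eq(3) by blast
    qed
  qed
  ultimately show ?thesis using xZ mB by (auto simp: integral_bases_def base_polyhedron_def PiE_iff)
qed

text \<open>Tightness passes to finite unions by uncrossing; \<open>p {} = 0\<close> makes the empty
  union tight.\<close>

lemma tight_S1:
  assumes S: "finite S" and p: "supermodular S p" "p {} = 0" and m: "m \<in> base_polyhedron S p"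
  shows "tight S p m (S1 S p m)"
proof -
  have U: "tight S p m (\<Union>G)" if "finite G" "\<And>X. X \<in> G \<Longrightarrow> tight S p m X" for G
    using that
  proof (induction G rule: finite_induct)
    case empty
    then show ?case using p(2) by (simp add: tight_def zero_ereal_def)
  next
    case (insert X G)
    then show ?case using tight_Un_Int(1)[OF S p(1) m, of X "\<Union>G"] by simp
  qed
  show ?thesis unfolding S1_def
    by (rule U) (use S smallest_tight_least(1)[OF S p(1) m] in auto)
qed

lemma beta1_components_subset_S1:
  assumes S: "finite S" and p: "supermodular S p" and m: "m \<in> base_polyhedron S p"
  shows "{s \<in> S. m s = of_int (beta1 S p)} \<subseteq> S1 S p m"
  using smallest_tight_least(2)[OF S p m] by (auto simp: S1_def)

text \<open>An integral component below \<beta> is at most \<beta> - 1, so each component is bounded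
  by \<beta> - 1 plus the indicator of being equal to \<beta>.\<close>

lemma sum_le_card_max_components:
  fixes x :: "'a \<Rightarrow> real"
  assumes A: "finite A" and x: "\<And>s. s \<in> A \<Longrightarrow> x s \<in> \<int> \<and> x s \<le> of_int \<beta>"
  shows "sum x A \<le> (real_of_int \<beta> - 1) * card A + card {s \<in> A. x s = of_int \<beta>}"
proof -
  have "sum x A \<le> (\<Sum>s\<in>A. (real_of_int \<beta> - 1) + (if x s = of_int \<beta> then 1 else 0))"
  proof (rule sum_mono)
    fix s assume "s \<in> A"
    then show "x s \<le> (real_of_int \<beta> - 1) + (if x s = of_int \<beta> then 1 else 0)"
      using x[of s] Ints_less_imp_le_minus_1[of "x s" "of_int \<beta>"] by auto
  qed
  also have "\<dots> = (real_of_int \<beta> - 1) * card A + card {s \<in> A. x s = of_int \<beta>}"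
    using A by (simp add: sum.distrib sum.If_cases Int_def mult.commute)
  finally show ?thesis .
qed

text \<open>The same indicator comparison in the opposite direction: the extra unit is charged only
  where the component equals \<beta>.\<close>

lemma card_max_components_le_sum:
  fixes x :: "'a \<Rightarrow> real"
  assumes A: "finite A" and x: "\<And>s. s \<in> A \<Longrightarrow> of_int \<beta> - 1 \<le> x s"
  shows "(real_of_int \<beta> - 1) * card A + card {s \<in> A. x s = of_int \<beta>} \<le> sum x A"
proof -
  have "(real_of_int \<beta> - 1) * card A + card {s \<in> A. x s = of_int \<beta>}
      = (\<Sum>s\<in>A. (real_of_int \<beta> - 1) + (if x s = of_int \<beta> then 1 else 0))"
    using A by (simp add: sum.distrib sum.If_cases Int_def mult.commute)
  also have "\<dots> \<le> sum x A"
    using x by (intro sum_mono) auto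
  finally show ?thesis .
qed

theorem theorem4p2:
  fixes S :: "'a set" and p :: "'a set \<Rightarrow> ereal" and m :: "'a \<Rightarrow> real"
  assumes "finite S" and "S \<noteq> {}"
    and "integer_or_minus_infinity_valued S p"
    and "supermodular S p"
    and "p {} = 0"
    and "\<bar>p S\<bar> \<noteq> \<infinity>"
    and "m \<in> integral_bases S p"
    and "covered S (beta1 S p) m"
  shows "pre_dec_min S p m \<longleftrightarrow> (\<forall>s\<in>S1 S p m. m s \<ge> of_int (beta1 S p) - 1)"
proof
  let ?b = "real_of_int (beta1 S p)"
  have mB: "m \<in> base_polyhedron S p"
    using assms(7) by (auto simp: integral_bases_def)
  {
    assume min: "pre_dec_min S p m"
    show "\<forall>s\<in>S1 S p m. m s \<ge> ?b - 1"
    proof (rule ballI, rule ccontr)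
      fix s assume s: "s \<in> S1 S p m" and "\<not> m s \<ge> ?b - 1"
      then have ms: "m s < ?b - 1" by simp
      obtain t where t: "t \<in> S" "m t = ?b" "s \<in> smallest_tight S p m t"
        using s by (auto simp: S1_def)
      have st: "s \<noteq> t" using ms t by auto
      let ?x = "m(t := m t - 1, s := m s + 1)"
      have x: "?x \<in> integral_bases S p"
        by (rule move_unit_integral_bases[OF assms(1,3,4,7) t(1,3) st])
      have "covered S (beta1 S p) ?x" using assms(8) ms t by (auto simp: covered_def)
      then have "card {s \<in> S. m s = ?b} \<le> card {s \<in> S. ?x s = ?b}"
        using min x unfolding pre_dec_min_def by blast
      moreover have "{s \<in> S. ?x s = ?b} \<subset> {s \<in> S. m s = ?b}"
      proof (rule psubsetI)
        show "{s \<in> S. ?x s = ?b} \<subseteq> {s \<in> S. m s = ?b}" using ms t(2) by auto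
        have "t \<in> {s \<in> S. m s = ?b}" "t \<notin> {s \<in> S. ?x s = ?b}" using t st by auto
        then show "{s \<in> S. ?x s = ?b} \<noteq> {s \<in> S. m s = ?b}" by blast
      qed
      then have "card {s \<in> S. ?x s = ?b} < card {s \<in> S. m s = ?b}"
        using assms(1) by (intro psubset_card_mono) simp_all
      ultimately show False by linarith
    qed
  next
    assume low: "\<forall>s\<in>S1 S p m. m s \<ge> ?b - 1"
    let ?A = "S1 S p m"
    have A: "?A \<subseteq> S" "ereal (sum m ?A) = p ?A"
      using tight_S1[OF assms(1,4,5) mB] by (auto simp: tight_def)
    have fin: "finite ?A" using A(1) assms(1) finite_subset by blast
    have "card {s \<in> S. m s = ?b} \<le> card {s \<in> S. x s = ?b}"
      if x: "x \<in> integral_bases S p" "covered S (beta1 S p) x" for x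
    proof -
      have "{s \<in> S. m s = ?b} = {s \<in> ?A. m s = ?b}"
        using beta1_components_subset_S1[OF assms(1,4) mB] A(1) by auto
      then have "(?b - 1) * card ?A + card {s \<in> S. m s = ?b} \<le> sum m ?A"
        using card_max_components_le_sum[OF fin, of "beta1 S p" m] low by simp
      \<comment> \<open>Tightness makes the left side equal to \<open>p ?A\<close>, which bounds the
        sum of every base over \<open>?A\<close> from below.\<close>
      also have "ereal (sum m ?A) \<le> ereal (sum x ?A)"
        using A x(1) by (auto simp: integral_bases_def base_polyhedron_def)
      then have "sum m ?A \<le> sum x ?A" by simp
      also have "sum x ?A \<le> (?b - 1) * card ?A + card {s \<in> ?A. x s = ?b}"
        using x A(1) by (intro sum_le_card_max_components[OF fin])
          (auto simp: integral_bases_def covered_def PiE_iff)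
      finally have "card {s \<in> S. m s = ?b} \<le> card {s \<in> ?A. x s = ?b}" by simp
      \<comment> \<open>Unlike \<open>m\<close>, the competitor \<open>x\<close> may have
        \<beta>-maximal components outside \<open>?A\<close>; they only increase its count.\<close>
      also have "\<dots> \<le> card {s \<in> S. x s = ?b}"
        using A(1) assms(1) by (intro card_mono) auto
      finally show ?thesis .
    qed
    then show "pre_dec_min S p m" using assms(7,8) by (simp add: pre_dec_min_def)
  }
qed

end
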